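(* Let $K$ be an arbitrary commutative $\mathbf{k}$-algebra with identity. Then every finitely or countably generated Lie $K$-algebra can be embedded (by an injective homomorphism of Lie $K$-algebras) into a Lie $K$-algebra generated by two elements.
   Context: $\mathbf{k}$ is a field. *)

theory Defs
  imports Main "HOL-Library.Countable_Set"
begin

text \<open>A commutative k-algebra with identity K is represented by a type 'k of class
comm_ring_1 together with its structure map phi from the field k, a unital ring
homomorphism.\<close>

definition alg_structure_map :: "('f::field \<Rightarrow> 'k::comm_ring_1) \<Rightarrow> bool" where
  "alg_structure_map phi \<longleftrightarrow>
     phi 1 = 1 \<and> (\<forall>a b. phi (a + b) = phi a + phi b) \<and> (\<forall>a b. phi (a * b) = phi a * phi b)"

record ('k, 'a) lie_alg =
  carrier :: "'a set"
  add :: "'a \<Rightarrow> 'a \<Rightarrow> 'a"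
  zero :: "'a"
  smul :: "'k \<Rightarrow> 'a \<Rightarrow> 'a"
  br :: "'a \<Rightarrow> 'a \<Rightarrow> 'a"

definition is_lie_algebra :: "('k::comm_ring_1, 'a) lie_alg \<Rightarrow> bool" where
  "is_lie_algebra A \<longleftrightarrow>
     (let C = carrier A; p = add A; z = zero A; s = smul A; b = br A in
       z \<in> C \<and>
       (\<forall>x\<in>C. \<forall>y\<in>C. p x y \<in> C) \<and>
       (\<forall>a. \<forall>x\<in>C. s a x \<in> C) \<and>
       (\<forall>x\<in>C. \<forall>y\<in>C. b x y \<in> C) \<and>
       \<comment> \<open>abelian group\<close>
       (\<forall>x\<in>C. \<forall>y\<in>C. \<forall>w\<in>C. p (p x y) w = p x (p y w)) \<and>
       (\<forall>x\<in>C. \<forall>y\<in>C. p x y = p y x) \<and>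
       (\<forall>x\<in>C. p z x = x) \<and>
       (\<forall>x\<in>C. \<exists>y\<in>C. p x y = z) \<and>
       \<comment> \<open>unital K-module\<close>
       (\<forall>a c. \<forall>x\<in>C. s (a + c) x = p (s a x) (s c x)) \<and>
       (\<forall>a. \<forall>x\<in>C. \<forall>y\<in>C. s a (p x y) = p (s a x) (s a y)) \<and>
       (\<forall>a c. \<forall>x\<in>C. s (a * c) x = s a (s c x)) \<and>
       (\<forall>x\<in>C. s 1 x = x) \<and>
       \<comment> \<open>K-bilinear bracket\<close>
       (\<forall>x\<in>C. \<forall>y\<in>C. \<forall>w\<in>C. b (p x y) w = p (b x w) (b y w)) \<and>
       (\<forall>x\<in>C. \<forall>y\<in>C. \<forall>w\<in>C. b w (p x y) = p (b w x) (b w y)) \<and>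
       (\<forall>a. \<forall>x\<in>C. \<forall>y\<in>C. b (s a x) y = s a (b x y)) \<and>
       (\<forall>a. \<forall>x\<in>C. \<forall>y\<in>C. b x (s a y) = s a (b x y)) \<and>
       \<comment> \<open>alternating and Jacobi identity\<close>
       (\<forall>x\<in>C. b x x = z) \<and>
       (\<forall>x\<in>C. \<forall>y\<in>C. \<forall>w\<in>C. p (p (b x (b y w)) (b y (b w x))) (b w (b x y)) = z))"

definition lie_span :: "('k, 'a) lie_alg \<Rightarrow> 'a set \<Rightarrow> 'a set" where
  "lie_span A S = \<Inter> {M. S \<subseteq> M \<and> M \<subseteq> carrier A \<and> zero A \<in> M \<and>
       (\<forall>x\<in>M. \<forall>y\<in>M. add A x y \<in> M) \<and>
       (\<forall>a. \<forall>x\<in>M. smul A a x \<in> M) \<and>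
       (\<forall>x\<in>M. \<forall>y\<in>M. br A x y \<in> M)}"

definition lie_hom :: "('k, 'a) lie_alg \<Rightarrow> ('k, 'b) lie_alg \<Rightarrow> ('a \<Rightarrow> 'b) \<Rightarrow> bool" where
  "lie_hom A B f \<longleftrightarrow>
     (\<forall>x\<in>carrier A. f x \<in> carrier B) \<and>
     (\<forall>x\<in>carrier A. \<forall>y\<in>carrier A. f (add A x y) = add B (f x) (f y)) \<and>
     (\<forall>a. \<forall>x\<in>carrier A. f (smul A a x) = smul B a (f x)) \<and>
     (\<forall>x\<in>carrier A. \<forall>y\<in>carrier A. f (br A x y) = br B (f x) (f y))"

end

theory Submission
  imports Defs "HOL-Computational_Algebra.Polynomial"
begin

text \<open>
  Let \<open>L\<close> be a Lie algebra over an arbitrary commutative ring \<open>K\<close>, generated by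
  \<open>x\<^sub>0, x\<^sub>1, \<dots>\<close>. Consider the Lie algebra of \<open>L\<close>-valued divided power series in the variables
  \<open>t\<^sub>0, t\<^sub>1, \<dots>\<close>, extended by the commuting derivations \<open>\<partial>\<^sub>n = \<partial>/\<partial>t\<^sub>n\<close> and by the derivation
  \<open>s = \<Sum>\<^sub>i t\<^sub>i \<partial>\<^sub>i\<^sub>+\<^sub>1\<close>, so that \<open>[\<partial>\<^sub>n, s] = \<partial>\<^sub>n\<^sub>+\<^sub>1\<close>. There is a quadratic series \<open>a\<close> which is
  annihilated by \<open>s\<close> and satisfies \<open>\<partial>\<^sub>n \<partial>\<^sub>m a = (-1)\<^sup>m x\<^sub>i\<close> whenever \<open>n + m = 2 i + 2\<close>. In the
  subalgebra generated by \<open>s\<close> and \<open>q = \<partial>\<^sub>0 + a\<close> one finds \<open>[q, s] = \<partial>\<^sub>1\<close>, hence all \<open>\<partial>\<^sub>n\<close> with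
  \<open>n \<ge> 1\<close>, and hence all the constants \<open>x\<^sub>i = \<plusminus>[\<partial>\<^sub>n, [\<partial>\<^sub>m, q]]\<close>. So \<open>L\<close>, embedded as the constant
  series, lies in this two-generated algebra.

  A divided power series is encoded without coordinates, as a symmetric multilinear function on
  lists of elements of the free module with basis \<open>\<partial>\<^sub>0, \<partial>\<^sub>1, \<dots>\<close>, the list
  \<open>[\<partial>\<^sub>n, \<partial>\<^sub>m, \<dots>]\<close> being sent to the constant term of \<open>\<cdots> \<partial>\<^sub>m \<partial>\<^sub>n f\<close>. The free module is taken
  to be \<open>K[X]\<close>, with \<open>\<partial>\<^sub>n = X\<^sup>n\<close>; then \<open>[v, s] = X v\<close>.
\<close>

section \<open>Lie algebras with explicit carrier\<close>

text \<open>The conjuncts of \<open>is_lie_algebra\<close> in the same order, in a form usable as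
  conditional rewrite rules. The case numbers in later proofs refer to this order: 6 is
  commutativity, 8 existence of negatives, 13 and 14 additivity of the bracket, 18 Jacobi.\<close>

locale lie_algebra =
  fixes A :: "('k::comm_ring_1, 'a) lie_alg"
  assumes zero_closed [simp]: "zero A \<in> carrier A"
    and add_closed [simp]: "\<And>x y. \<lbrakk>x \<in> carrier A; y \<in> carrier A\<rbrakk> \<Longrightarrow> add A x y \<in> carrier A"
    and smul_closed [simp]: "\<And>c x. x \<in> carrier A \<Longrightarrow> smul A c x \<in> carrier A"
    and br_closed [simp]: "\<And>x y. \<lbrakk>x \<in> carrier A; y \<in> carrier A\<rbrakk> \<Longrightarrow> br A x y \<in> carrier A"
    and add_assoc: "\<And>x y w. \<lbrakk>x \<in> carrier A; y \<in> carrier A; w \<in> carrier A\<rbrakk>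
          \<Longrightarrow> add A (add A x y) w = add A x (add A y w)"
    and add_comm: "\<And>x y. \<lbrakk>x \<in> carrier A; y \<in> carrier A\<rbrakk> \<Longrightarrow> add A x y = add A y x"
    and zero_add [simp]: "\<And>x. x \<in> carrier A \<Longrightarrow> add A (zero A) x = x"
    and ex_neg: "\<And>x. x \<in> carrier A \<Longrightarrow> \<exists>y\<in>carrier A. add A x y = zero A"
    and smul_add_left: "\<And>c d x. x \<in> carrier A
          \<Longrightarrow> smul A (c + d) x = add A (smul A c x) (smul A d x)"
    and smul_add_right: "\<And>c x y. \<lbrakk>x \<in> carrier A; y \<in> carrier A\<rbrakk>
          \<Longrightarrow> smul A c (add A x y) = add A (smul A c x) (smul A c y)"
    and smul_mult: "\<And>c d x. x \<in> carrier A \<Longrightarrow> smul A (c * d) x = smul A c (smul A d x)"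
    and smul_one [simp]: "\<And>x. x \<in> carrier A \<Longrightarrow> smul A 1 x = x"
    and br_add_left: "\<And>x y w. \<lbrakk>x \<in> carrier A; y \<in> carrier A; w \<in> carrier A\<rbrakk>
          \<Longrightarrow> br A (add A x y) w = add A (br A x w) (br A y w)"
    and br_add_right: "\<And>x y w. \<lbrakk>x \<in> carrier A; y \<in> carrier A; w \<in> carrier A\<rbrakk>
          \<Longrightarrow> br A w (add A x y) = add A (br A w x) (br A w y)"
    and br_smul_left: "\<And>c x y. \<lbrakk>x \<in> carrier A; y \<in> carrier A\<rbrakk>
          \<Longrightarrow> br A (smul A c x) y = smul A c (br A x y)"
    and br_smul_right: "\<And>c x y. \<lbrakk>x \<in> carrier A; y \<in> carrier A\<rbrakk>
          \<Longrightarrow> br A x (smul A c y) = smul A c (br A x y)"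
    and br_self [simp]: "\<And>x. x \<in> carrier A \<Longrightarrow> br A x x = zero A"
    and jacobi: "\<And>x y w. \<lbrakk>x \<in> carrier A; y \<in> carrier A; w \<in> carrier A\<rbrakk>
          \<Longrightarrow> add A (add A (br A x (br A y w)) (br A y (br A w x))) (br A w (br A x y)) = zero A"

lemma lie_algebra_iff: "lie_algebra A \<longleftrightarrow> is_lie_algebra A"
  by (simp only: lie_algebra_def is_lie_algebra_def Let_def Ball_def all_simps(6) conj_assoc)

context lie_algebra
begin

abbreviation plus' (infixl "\<oplus>" 65) where "x \<oplus> y \<equiv> add A x y"
abbreviation zero' ("\<zero>") where "\<zero> \<equiv> zero A"
abbreviation scale' (infixr "\<odot>" 75) where "c \<odot> x \<equiv> smul A c x"
abbreviation bracket' ("\<lbrace>_, _\<rbrace>") where "\<lbrace>x, y\<rbrace> \<equiv> br A x y"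

lemma add_left_comm:
  "\<lbrakk>x \<in> carrier A; y \<in> carrier A; w \<in> carrier A\<rbrakk> \<Longrightarrow> x \<oplus> (y \<oplus> w) = y \<oplus> (x \<oplus> w)"
  using add_comm[of x y] add_assoc[of x y w] add_assoc[of y x w] by simp

lemmas add_ac = add_assoc add_comm add_left_comm

lemma add_zero [simp]: "x \<in> carrier A \<Longrightarrow> x \<oplus> \<zero> = x"
  using add_comm[of x \<zero>] by simp

lemma add_left_cancel:
  assumes "x \<in> carrier A" "y \<in> carrier A" "w \<in> carrier A" "x \<oplus> y = x \<oplus> w"
  shows "y = w"
proof -
  obtain n where n: "n \<in> carrier A" "x \<oplus> n = \<zero>" using ex_neg assms by blast
  have "n \<oplus> (x \<oplus> y) = y" "n \<oplus> (x \<oplus> w) = w"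
    using n assms(1-3) add_comm[of n x] add_assoc[of n x y] add_assoc[of n x w] by simp_all
  then show ?thesis using assms(4) by metis
qed

lemma smul_zero_left [simp]:
  assumes "x \<in> carrier A" shows "0 \<odot> x = \<zero>"
proof (rule add_left_cancel)
  show "0 \<odot> x \<oplus> 0 \<odot> x = 0 \<odot> x \<oplus> \<zero>"
    using smul_add_left[of x 0 0] assms by simp
qed (use assms in auto)

lemma smul_zero_right [simp]: "c \<odot> \<zero> = \<zero>"
  by (metis mult_zero_right smul_mult smul_zero_left zero_closed)

lemma br_zero_left [simp]: "x \<in> carrier A \<Longrightarrow> \<lbrace>\<zero>, x\<rbrace> = \<zero>"
  by (metis br_closed br_smul_left smul_zero_left zero_closed)

lemma br_zero_right [simp]: "x \<in> carrier A \<Longrightarrow> \<lbrace>x, \<zero>\<rbrace> = \<zero>"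
  by (metis br_closed br_smul_right smul_zero_left zero_closed)

lemma add_neg [simp]: "x \<in> carrier A \<Longrightarrow> x \<oplus> (- 1) \<odot> x = \<zero>"
  using smul_add_left[of x 1 "- 1"] by simp

lemma neg_add [simp]: "x \<in> carrier A \<Longrightarrow> (- 1) \<odot> x \<oplus> x = \<zero>"
  using add_comm[of x "(- 1) \<odot> x"] by simp

lemma add_neg_cancel [simp]:
  "\<lbrakk>x \<in> carrier A; y \<in> carrier A\<rbrakk> \<Longrightarrow> x \<oplus> ((- 1) \<odot> x \<oplus> y) = y"
  "\<lbrakk>x \<in> carrier A; y \<in> carrier A\<rbrakk> \<Longrightarrow> (- 1) \<odot> x \<oplus> (x \<oplus> y) = y"
  by (simp_all add: add_assoc[symmetric])

lemma neg_unique: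
  "\<lbrakk>x \<in> carrier A; y \<in> carrier A; x \<oplus> y = \<zero>\<rbrakk> \<Longrightarrow> y = (- 1) \<odot> x"
  by (metis add_left_cancel add_neg smul_closed)

lemma neg_neg [simp]: "x \<in> carrier A \<Longrightarrow> (- 1) \<odot> (- 1) \<odot> x = x"
  by (simp flip: smul_mult)

lemma br_anti_sum:
  assumes "x \<in> carrier A" "y \<in> carrier A" shows "\<lbrace>x, y\<rbrace> \<oplus> \<lbrace>y, x\<rbrace> = \<zero>"
proof -
  have "\<zero> = \<lbrace>x \<oplus> y, x \<oplus> y\<rbrace>" using assms by simp
  also have "\<dots> = \<lbrace>x, y\<rbrace> \<oplus> \<lbrace>y, x\<rbrace>"
    using assms by (simp add: br_add_left br_add_right add_ac br_self[OF assms(1)]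
        br_self[OF assms(2)] del: br_self)
  finally show ?thesis by simp
qed

lemma br_anti: "\<lbrakk>x \<in> carrier A; y \<in> carrier A\<rbrakk> \<Longrightarrow> \<lbrace>y, x\<rbrace> = (- 1) \<odot> \<lbrace>x, y\<rbrace>"
  by (simp add: br_anti_sum neg_unique)

end

section \<open>Subalgebras and generated subalgebras\<close>

definition lie_subalgebra :: "('k, 'a) lie_alg \<Rightarrow> 'a set \<Rightarrow> bool" where
  "lie_subalgebra A M \<longleftrightarrow> M \<subseteq> carrier A \<and> zero A \<in> M \<and>
     (\<forall>x\<in>M. \<forall>y\<in>M. add A x y \<in> M) \<and> (\<forall>a. \<forall>x\<in>M. smul A a x \<in> M) \<and>
     (\<forall>x\<in>M. \<forall>y\<in>M. br A x y \<in> M)"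

lemma lie_span_eq: "lie_span A S = \<Inter> {M. S \<subseteq> M \<and> lie_subalgebra A M}"
  by (simp add: lie_span_def lie_subalgebra_def)

lemma lie_span_least: "\<lbrakk>S \<subseteq> M; lie_subalgebra A M\<rbrakk> \<Longrightarrow> lie_span A S \<subseteq> M"
  unfolding lie_span_eq by blast

lemma lie_span_superset: "S \<subseteq> lie_span A S"
  unfolding lie_span_eq by blast

lemma (in lie_algebra) lie_subalgebra_carrier: "lie_subalgebra A (carrier A)"
  by (simp add: lie_subalgebra_def)

lemma (in lie_algebra) lie_subalgebra_span:
  assumes "S \<subseteq> carrier A" shows "lie_subalgebra A (lie_span A S)"
proof -
  have "lie_span A S \<subseteq> carrier A"
    by (rule lie_span_least[OF assms lie_subalgebra_carrier])
  then show ?thesis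
    unfolding lie_subalgebra_def by (auto simp: lie_span_eq lie_subalgebra_def)
qed

lemma (in lie_algebra) lie_algebra_subalgebra:
  assumes "lie_subalgebra A M" shows "lie_algebra (A\<lparr>carrier := M\<rparr>)"
proof -
  have M: "x \<in> carrier A" if "x \<in> M" for x
    using assms that by (auto simp: lie_subalgebra_def)
  show ?thesis
  proof (rule lie_algebra.intro, goal_cases)
    \<comment> \<open>Closure under scalars puts the negative \<open>(- 1) \<odot> x\<close> into
      \<open>M\<close>.\<close>
    case (8 x)
    then show ?case
      using assms M by (intro bexI[of _ "(- 1) \<odot> x"]) (auto simp: lie_subalgebra_def)
  next
    case (6 x y)
    then show ?case using M add_comm by simp
  next
    case (18 x y w)
    then show ?case using M jacobi by simp
  qed (use assms in \<open>simp_all add: lie_subalgebra_def M add_assoc smul_add_left smul_add_right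
        smul_mult br_add_left br_add_right br_smul_left br_smul_right\<close>)
qed

section \<open>Cardinality of the span and transport of structure\<close>

unbundle cardinal_syntax

text \<open>The ambient algebra will live on a function type, while the target type
  \<open>nat \<times> 'k\<close> is fixed; this bound makes the generated subalgebra fit. The span
  is covered by countably many rounds of closure under the operations, none of which leaves the
  infinite cardinal of \<open>U\<close>.\<close>

lemma card_of_lie_span:
  fixes A :: "('k::comm_ring_1, 'a) lie_alg" and U :: "'u set"
  assumes "lie_algebra A" "S \<subseteq> carrier A" "infinite U" "|S| \<le>o |U|" "|UNIV :: 'k set| \<le>o |U|"
  shows "|lie_span A S| \<le>o |U|"
proof -
  interpret lie_algebra A by fact
  \<comment> \<open>Keeping \<open>M\<close> inside \<open>step M\<close> makes the stages increase,
    so any two elements of the union already share a stage.\<close>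
  define step where "step M = (M \<union> (\<lambda>(x, y). x \<oplus> y) ` (M \<times> M)) \<union>
    ((\<lambda>(c, x). c \<odot> x) ` (UNIV \<times> M) \<union> (\<lambda>(x, y). \<lbrace>x, y\<rbrace>) ` (M \<times> M))" for M
  define T where "T n = (step ^^ n) (insert \<zero> S)" for n
  have T0: "T 0 = insert \<zero> S" and TS: "T (Suc n) = step (T n)" for n
    by (simp_all add: T_def)
  have img: "|f ` (B \<times> C)| \<le>o |U|" if "|B| \<le>o |U|" "|C| \<le>o |U|"
    for f :: "'b \<times> 'c \<Rightarrow> 'a" and B C
    by (rule ordLeq_transitive[OF card_of_image card_of_Sigma_ordLeq_infinite[OF assms(3) that(1)]])
      (simp add: that(2))
  have un: "|B \<union> C| \<le>o |U|" if "|B| \<le>o |U|" "|C| \<le>o |U|" for B C :: "'a set"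
    using that assms(3)
    by (intro card_of_Un_ordLeq_infinite_Field) (simp_all add: Field_card_of card_of_card_order_on)
  have "|T n| \<le>o |U|" for n
  proof (induction n)
    case 0
    obtain z where "z \<in> U" using assms(3) by fastforce
    then have "|{\<zero>}| \<le>o |U|"
      by (metis card_of_singl_ordLeq empty_iff)
    then show ?case
      using un[OF _ assms(4), of "{\<zero>}"] by (simp add: T0)
  next
    case (Suc n)
    show ?case
      unfolding TS step_def
      by (intro un img Suc assms(5))
  qed
  then have *: "|\<Union>n. T n| \<le>o |U|"
    using assms(3) by (intro card_of_UNION_ordLeq_infinite) (auto simp: infinite_iff_card_of_nat)
  have mono: "T m \<subseteq> T n" if "m \<le> n" for m n
    using that by (induction rule: dec_induct) (auto simp: TS step_def)
  have carr: "T n \<subseteq> carrier A" for n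
    by (induction n) (use assms(2) in \<open>auto simp: T0 TS step_def intro!: add_closed smul_closed br_closed\<close>)
  have common: "\<exists>n. x \<in> T n \<and> y \<in> T n" if "x \<in> T m" "y \<in> T k" for x y m k
    using that mono[of m "max m k"] mono[of k "max m k"] by auto
  have "lie_subalgebra A (\<Union>n. T n)"
    unfolding lie_subalgebra_def
  proof (intro conjI ballI allI)
    show "(\<Union>n. T n) \<subseteq> carrier A" using carr by blast
    show "\<zero> \<in> (\<Union>n. T n)" using T0 by blast
  next
    fix x y assume "x \<in> (\<Union>n. T n)" "y \<in> (\<Union>n. T n)"
    then obtain n where "x \<in> T n" "y \<in> T n" using common by blast
    then have "(x, y) \<in> T n \<times> T n" by simp
    then have "x \<oplus> y \<in> T (Suc n)" "\<lbrace>x, y\<rbrace> \<in> T (Suc n)"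
      unfolding TS step_def by force+
    then show "x \<oplus> y \<in> (\<Union>n. T n)" "\<lbrace>x, y\<rbrace> \<in> (\<Union>n. T n)" by blast+
  next
    fix c :: 'k and x assume "x \<in> (\<Union>n. T n)"
    then obtain n where "x \<in> T n" by blast
    then have "(c, x) \<in> UNIV \<times> T n" by simp
    then have "c \<odot> x \<in> T (Suc n)"
      unfolding TS step_def by force
    then show "c \<odot> x \<in> (\<Union>n. T n)" by blast
  qed
  moreover have "S \<subseteq> (\<Union>n. T n)" using T0 by blast
  ultimately have "lie_span A S \<subseteq> (\<Union>n. T n)" by (intro lie_span_least)
  then show ?thesis
    using card_of_mono1 * ordLeq_transitive by blast
qed

section \<open>Transport of structure along an injection of the carrier\<close>

definition transport :: "('a \<Rightarrow> 'b) \<Rightarrow> ('k, 'a) lie_alg \<Rightarrow> ('k, 'b) lie_alg" where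
  "transport g A = (let h = inv_into (carrier A) g in
     \<lparr>carrier = g ` carrier A, add = (\<lambda>x y. g (add A (h x) (h y))), zero = g (zero A),
      smul = (\<lambda>c x. g (smul A c (h x))), br = (\<lambda>x y. g (br A (h x) (h y)))\<rparr>)"

context lie_algebra
begin

context
  fixes g :: "'a \<Rightarrow> 'b"
  assumes inj: "inj_on g (carrier A)"
begin

lemma transport_simps [simp]:
  "carrier (transport g A) = g ` carrier A"
  "zero (transport g A) = g \<zero>"
  "\<lbrakk>x \<in> carrier A; y \<in> carrier A\<rbrakk> \<Longrightarrow> add (transport g A) (g x) (g y) = g (x \<oplus> y)"
  "x \<in> carrier A \<Longrightarrow> smul (transport g A) c (g x) = g (c \<odot> x)"
  "\<lbrakk>x \<in> carrier A; y \<in> carrier A\<rbrakk> \<Longrightarrow> br (transport g A) (g x) (g y) = g \<lbrace>x, y\<rbrace>"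
  by (simp_all add: transport_def Let_def inj)

lemma lie_algebra_transport: "lie_algebra (transport g A)"
proof (rule lie_algebra.intro, goal_cases)
  case (6 x y)
  then show ?case by (auto simp: add_comm)
next
  case (8 x)
  then show ?case by (intro bexI[of _ "smul (transport g A) (- 1) x"]) auto
next
  case (18 x y w)
  then show ?case by (auto simp: jacobi)
qed (auto simp: add_assoc smul_add_left smul_add_right smul_mult
    br_add_left br_add_right br_smul_left br_smul_right)

lemma lie_span_transport:
  assumes "S \<subseteq> carrier A" "lie_span A S = carrier A"
  shows "lie_span (transport g A) (g ` S) = carrier (transport g A)"
proof
  interpret T: lie_algebra "transport g A" by (rule lie_algebra_transport)
  have sub: "g ` S \<subseteq> carrier (transport g A)" using assms by auto
  note span = T.lie_subalgebra_span[OF sub]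
  then show "lie_span (transport g A) (g ` S) \<subseteq> carrier (transport g A)"
    by (simp add: lie_subalgebra_def)
  \<comment> \<open>The preimage of the new span is a subalgebra of \<open>A\<close> containing
    \<open>S\<close>, hence all of \<open>A\<close>.\<close>
  let ?M = "{x \<in> carrier A. g x \<in> lie_span (transport g A) (g ` S)}"
  have "lie_subalgebra A ?M"
    using span by (auto simp: lie_subalgebra_def simp flip: transport_simps(2-5))
  moreover have "S \<subseteq> ?M" using assms lie_span_superset[of "g ` S" "transport g A"] by auto
  ultimately have "carrier A \<subseteq> ?M" using lie_span_least assms(2) by metis
  then show "carrier (transport g A) \<subseteq> lie_span (transport g A) (g ` S)" by auto
qed

end

end

section \<open>Semidirect products\<close>

text \<open>Read \<open>(x, e)\<close> as \<open>x + e\<close>, with \<open>A\<close> an ideal on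
  which \<open>E\<close> acts by derivations: \<open>[e, y] = act e y\<close>, and therefore
  \<open>[x, d] = - act d x\<close>.\<close>

definition semidirect ::
    "('k, 'a) lie_alg \<Rightarrow> ('k, 'e) lie_alg \<Rightarrow> ('e \<Rightarrow> 'a \<Rightarrow> 'a) \<Rightarrow> ('k::comm_ring_1, 'a \<times> 'e) lie_alg" where
  "semidirect A E act = \<lparr>carrier = carrier A \<times> carrier E,
     add = (\<lambda>(x, e) (y, d). (add A x y, add E e d)), zero = (zero A, zero E),
     smul = (\<lambda>c (x, e). (smul A c x, smul E c e)),
     br = (\<lambda>(x, e) (y, d).
       (add A (add A (br A x y) (act e y)) (smul A (- 1) (act d x)), br E e d))\<rparr>"

lemma semidirect_simps [simp]:
  "carrier (semidirect A E act) = carrier A \<times> carrier E"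
  "add (semidirect A E act) (x, e) (y, d) = (add A x y, add E e d)"
  "zero (semidirect A E act) = (zero A, zero E)"
  "smul (semidirect A E act) c (x, e) = (smul A c x, smul E c e)"
  "br (semidirect A E act) (x, e) (y, d) =
     (add A (add A (br A x y) (act e y)) (smul A (- 1) (act d x)), br E e d)"
  by (simp_all add: semidirect_def)

locale lie_action = lie_algebra A for A :: "('k::comm_ring_1, 'a) lie_alg" +
  fixes E :: "('k, 'e) lie_alg" and act :: "'e \<Rightarrow> 'a \<Rightarrow> 'a"
  assumes lie_algebra_E: "lie_algebra E"
    and act_closed [simp]: "\<And>e x. \<lbrakk>e \<in> carrier E; x \<in> carrier A\<rbrakk> \<Longrightarrow> act e x \<in> carrier A"
    and act_add_right: "\<And>e x y. \<lbrakk>e \<in> carrier E; x \<in> carrier A; y \<in> carrier A\<rbrakk>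
          \<Longrightarrow> act e (x \<oplus> y) = act e x \<oplus> act e y"
    and act_smul_right: "\<And>e c x. \<lbrakk>e \<in> carrier E; x \<in> carrier A\<rbrakk> \<Longrightarrow> act e (c \<odot> x) = c \<odot> act e x"
    and act_add_left: "\<And>e d x. \<lbrakk>e \<in> carrier E; d \<in> carrier E; x \<in> carrier A\<rbrakk>
          \<Longrightarrow> act (add E e d) x = act e x \<oplus> act d x"
    and act_smul_left: "\<And>c e x. \<lbrakk>e \<in> carrier E; x \<in> carrier A\<rbrakk>
          \<Longrightarrow> act (smul E c e) x = c \<odot> act e x"
    and act_derivation: "\<And>e x y. \<lbrakk>e \<in> carrier E; x \<in> carrier A; y \<in> carrier A\<rbrakk>
          \<Longrightarrow> act e \<lbrace>x, y\<rbrace> = \<lbrace>act e x, y\<rbrace> \<oplus> \<lbrace>x, act e y\<rbrace>"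
    and act_commutator: "\<And>e d x. \<lbrakk>e \<in> carrier E; d \<in> carrier E; x \<in> carrier A\<rbrakk>
          \<Longrightarrow> act (br E e d) x = act e (act d x) \<oplus> (- 1) \<odot> act d (act e x)"
begin

lemma smul_neg_comm: "x \<in> carrier A \<Longrightarrow> c \<odot> (- 1) \<odot> x = (- 1) \<odot> c \<odot> x"
  by (simp add: mult.commute flip: smul_mult)

text \<open>The grouping prepares the Jacobi identity. In the cyclic sum the first summand vanishes
  by Jacobi in \<open>A\<close>; each of the other four is a term minus one of its own cyclic
  shifts, so it telescopes.\<close>

lemma semidirect_double_bracket:
  assumes "x1 \<in> carrier A" "x2 \<in> carrier A" "x3 \<in> carrier A"
    and "e1 \<in> carrier E" "e2 \<in> carrier E" "e3 \<in> carrier E"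
  shows "fst (br (semidirect A E act) (x1, e1) (br (semidirect A E act) (x2, e2) (x3, e3))) =
     \<lbrace>x1, \<lbrace>x2, x3\<rbrace>\<rbrace> \<oplus> (\<lbrace>x1, act e2 x3\<rbrace> \<oplus> (- 1) \<odot> \<lbrace>x3, act e1 x2\<rbrace>)
     \<oplus> (\<lbrace>x2, act e1 x3\<rbrace> \<oplus> (- 1) \<odot> \<lbrace>x1, act e3 x2\<rbrace>)
     \<oplus> (act e1 (act e2 x3) \<oplus> (- 1) \<odot> act e2 (act e3 x1))
     \<oplus> (act e3 (act e2 x1) \<oplus> (- 1) \<odot> act e1 (act e3 x2))"
proof -
  \<comment> \<open>One half of the Leibniz expansion of
    \<open>act e1 \<lbrace>x2, x3\<rbrace>\<close>, turned round so that it becomes a cyclic shift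
    of \<open>\<lbrace>x1, act e2 x3\<rbrace>\<close>.\<close>
  have "\<lbrace>act e1 x2, x3\<rbrace> = (- 1) \<odot> \<lbrace>x3, act e1 x2\<rbrace>"
    using assms by (intro br_anti) auto
  then show ?thesis
    using assms
    by (simp add: br_add_right act_add_right act_smul_right br_smul_right act_derivation
        act_commutator smul_add_right)
      (simp add: add_ac)
qed

lemma lie_algebra_semidirect: "lie_algebra (semidirect A E act)"
proof -
  interpret E: lie_algebra E by (rule lie_algebra_E)
  \<comment> \<open>The two telescoping patterns: a term minus its predecessor here, a term minus
    its successor in \<open>cyclic'\<close>.\<close>
  have cyclic: "(a \<oplus> (- 1) \<odot> c) \<oplus> (b \<oplus> (- 1) \<odot> a) \<oplus> (c \<oplus> (- 1) \<odot> b) = \<zero>"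
    if "a \<in> carrier A" "b \<in> carrier A" "c \<in> carrier A" for a b c
  proof -
    have "(a \<oplus> (- 1) \<odot> c) \<oplus> (b \<oplus> (- 1) \<odot> a) \<oplus> (c \<oplus> (- 1) \<odot> b)
        = (a \<oplus> (- 1) \<odot> a) \<oplus> (b \<oplus> (- 1) \<odot> b) \<oplus> (c \<oplus> (- 1) \<odot> c)"
      using that by (simp add: add_ac del: add_neg neg_add add_neg_cancel)
    then show ?thesis using that by simp
  qed
  have cyclic': "(a \<oplus> (- 1) \<odot> b) \<oplus> (b \<oplus> (- 1) \<odot> c) \<oplus> (c \<oplus> (- 1) \<odot> a) = \<zero>"
    if "a \<in> carrier A" "b \<in> carrier A" "c \<in> carrier A" for a b c
    using that by (simp add: add_assoc)
  \<comment> \<open>Each of the three double brackets is a row of five summands; the total is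
    computed column by column.\<close>
  have columns: "(a1 \<oplus> b1 \<oplus> c1 \<oplus> d1 \<oplus> e1) \<oplus> (a2 \<oplus> b2 \<oplus> c2 \<oplus> d2 \<oplus> e2) \<oplus> (a3 \<oplus> b3 \<oplus> c3 \<oplus> d3 \<oplus> e3)
      = \<zero>"
    if "a1 \<oplus> a2 \<oplus> a3 = \<zero>" "b1 \<oplus> b2 \<oplus> b3 = \<zero>" "c1 \<oplus> c2 \<oplus> c3 = \<zero>" "d1 \<oplus> d2 \<oplus> d3 = \<zero>"
      "e1 \<oplus> e2 \<oplus> e3 = \<zero>" and
      "{a1, b1, c1, d1, e1, a2, b2, c2, d2, e2, a3, b3, c3, d3, e3} \<subseteq> carrier A"
    for a1 b1 c1 d1 e1 a2 b2 c2 d2 e2 a3 b3 c3 d3 e3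
  proof -
    have "(a1 \<oplus> b1 \<oplus> c1 \<oplus> d1 \<oplus> e1) \<oplus> (a2 \<oplus> b2 \<oplus> c2 \<oplus> d2 \<oplus> e2) \<oplus> (a3 \<oplus> b3 \<oplus> c3 \<oplus> d3 \<oplus> e3)
      = (a1 \<oplus> a2 \<oplus> a3) \<oplus> (b1 \<oplus> b2 \<oplus> b3) \<oplus> (c1 \<oplus> c2 \<oplus> c3) \<oplus> (d1 \<oplus> d2 \<oplus> d3) \<oplus> (e1 \<oplus> e2 \<oplus> e3)"
      using that(6) by (simp add: add_ac)
    then show ?thesis by (simp add: that)
  qed
  let ?W = "semidirect A E act"
  have jac: "add ?W (add ?W (br ?W X (br ?W Y Z)) (br ?W Y (br ?W Z X))) (br ?W Z (br ?W X Y)) = zero ?W"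
    if "X \<in> carrier ?W" "Y \<in> carrier ?W" "Z \<in> carrier ?W" for X Y Z
  proof -
    obtain x d y e z f where X: "X = (x, d)" "Y = (y, e)" "Z = (z, f)"
      by (metis surj_pair)
    have cl: "x \<in> carrier A" "y \<in> carrier A" "z \<in> carrier A" "d \<in> carrier E" "e \<in> carrier E"
      "f \<in> carrier E"
      using that X by auto
    have pair: "add ?W P Q = (fst P \<oplus> fst Q, add E (snd P) (snd Q))" for P Q
      by (cases P; cases Q) simp
    have "fst (br ?W X (br ?W Y Z)) \<oplus> fst (br ?W Y (br ?W Z X)) \<oplus> fst (br ?W Z (br ?W X Y)) = \<zero>"
      unfolding X semidirect_double_bracket[OF cl]
        semidirect_double_bracket[OF cl(2,3,1,5,6,4)] semidirect_double_bracket[OF cl(3,1,2,6,4,5)]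
      by (rule columns) (use cl in \<open>simp_all add: jacobi cyclic cyclic'\<close>)
    moreover have "snd (br ?W X (br ?W Y Z)) = br E d (br E e f)"
      "snd (br ?W Y (br ?W Z X)) = br E e (br E f d)"
      "snd (br ?W Z (br ?W X Y)) = br E f (br E d e)"
      by (simp_all add: X)
    ultimately show ?thesis
      using cl by (simp add: pair E.jacobi)
  qed
  show ?thesis
  proof (rule lie_algebra.intro, goal_cases)
    case (6 X Y)
    then show ?case by (auto simp: add_comm E.add_comm)
  next
    case (8 X)
    then show ?case by (intro bexI[of _ "smul ?W (- 1) X"]) auto
  next
    case 18
    then show ?case by (rule jac)
  next
    case (13 X Y Z)
    then show ?case
      by (auto simp: br_add_left E.br_add_left act_add_left act_add_right smul_add_right)
        (simp add: add_ac)
  next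
    case (14 X Y Z)
    then show ?case
      by (auto simp: br_add_right E.br_add_right act_add_left act_add_right smul_add_right)
        (simp add: add_ac)
  qed (auto simp: add_assoc E.add_assoc smul_add_left E.smul_add_left smul_add_right
      E.smul_add_right smul_mult E.smul_mult br_smul_left br_smul_right E.br_smul_left
      E.br_smul_right act_smul_left act_smul_right smul_neg_comm)
qed

end

section \<open>Lie-valued divided power series\<close>

abbreviation (input) pd :: "'v \<Rightarrow> ('v list \<Rightarrow> 'a) \<Rightarrow> 'v list \<Rightarrow> 'a" where
  "pd v f \<equiv> \<lambda>w. f (v # w)"

text \<open>The recursion is the Leibniz rule for the partial derivatives \<open>pd v\<close>: every identity of the
  bracket of \<open>A\<close> then passes to functions by induction on the list.\<close>

primrec shuffle_br :: "('k, 'a) lie_alg \<Rightarrow> ('v list \<Rightarrow> 'a) \<Rightarrow> ('v list \<Rightarrow> 'a) \<Rightarrow> 'v list \<Rightarrow> 'a" where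
  "shuffle_br A f g [] = br A (f []) (g [])"
| "shuffle_br A f g (v # w) = add A (shuffle_br A (pd v f) g w) (shuffle_br A f (pd v g) w)"

definition fun_alg :: "('k, 'a) lie_alg \<Rightarrow> ('k, 'v list \<Rightarrow> 'a) lie_alg" where
  "fun_alg A = \<lparr>carrier = {f. \<forall>w. f w \<in> carrier A}, add = (\<lambda>f g w. add A (f w) (g w)),
     zero = (\<lambda>w. zero A), smul = (\<lambda>c f w. smul A c (f w)), br = shuffle_br A\<rparr>"

lemma fun_alg_simps [simp]:
  "f \<in> carrier (fun_alg A) \<longleftrightarrow> (\<forall>w. f w \<in> carrier A)"
  "add (fun_alg A) f g = (\<lambda>w. add A (f w) (g w))"
  "zero (fun_alg A) = (\<lambda>w. zero A)"
  "smul (fun_alg A) c f = (\<lambda>w. smul A c (f w))"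
  "br (fun_alg A) = shuffle_br A"
  by (simp_all add: fun_alg_def)

context lie_algebra
begin

lemma add_swap:
  "\<lbrakk>x \<in> carrier A; y \<in> carrier A; z \<in> carrier A; w \<in> carrier A\<rbrakk>
    \<Longrightarrow> (x \<oplus> y) \<oplus> (z \<oplus> w) = (x \<oplus> z) \<oplus> (y \<oplus> w)"
  by (simp add: add_ac)

lemma shuffle_br_closed [simp]:
  "\<lbrakk>\<And>w. f w \<in> carrier A; \<And>w. g w \<in> carrier A\<rbrakk> \<Longrightarrow> shuffle_br A f g w \<in> carrier A"
  by (induction w arbitrary: f g) simp_all

lemma shuffle_br_add_left:
  "\<lbrakk>\<And>w. f w \<in> carrier A; \<And>w. g w \<in> carrier A; \<And>w. h w \<in> carrier A\<rbrakk>
    \<Longrightarrow> shuffle_br A (\<lambda>w. f w \<oplus> g w) h w = shuffle_br A f h w \<oplus> shuffle_br A g h w"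
proof (induction w arbitrary: f g h)
  case (Cons v w)
  then show ?case
    using Cons.IH[of "pd v f" "pd v g" h] Cons.IH[of f g "pd v h"]
    by (simp add: add_swap)
qed (simp add: br_add_left)

lemma shuffle_br_smul_left:
  "\<lbrakk>\<And>w. f w \<in> carrier A; \<And>w. g w \<in> carrier A\<rbrakk>
    \<Longrightarrow> shuffle_br A (\<lambda>w. c \<odot> f w) g w = c \<odot> shuffle_br A f g w"
proof (induction w arbitrary: f g)
  case (Cons v w)
  then show ?case
    using Cons.IH[of "pd v f" g] Cons.IH[of f "pd v g"]
    by (simp add: smul_add_right)
qed (simp add: br_smul_left)

lemma shuffle_br_anti:
  "\<lbrakk>\<And>w. f w \<in> carrier A; \<And>w. g w \<in> carrier A\<rbrakk>
    \<Longrightarrow> shuffle_br A g f w = (- 1) \<odot> shuffle_br A f g w"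
proof (induction w arbitrary: f g)
  case Nil
  then show ?case by (simp add: br_anti[of "f []" "g []"])
next
  case (Cons v w)
  show ?case
    using Cons.prems Cons.IH[of "pd v f" g] Cons.IH[of f "pd v g"]
    by (simp add: smul_add_right add_comm)
qed

text \<open>Antisymmetry of the value itself would not suffice, since 2 may be a zero divisor.
  Instead the two Leibniz terms, with the derivative on the left and on the right factor, are
  negatives of each other; the empty list is the alternating law of \<open>A\<close>.\<close>

lemma shuffle_br_self:
  "(\<And>w. f w \<in> carrier A) \<Longrightarrow> shuffle_br A f f w = \<zero>"
proof (induction w)
  case (Cons v w)
  show ?case
    using Cons.prems shuffle_br_anti[of "pd v f" f w] by simp
qed simp

lemma shuffle_br_add_right:
  assumes "\<And>w. f w \<in> carrier A" "\<And>w. g w \<in> carrier A" "\<And>w. h w \<in> carrier A"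
  shows "shuffle_br A h (\<lambda>w. f w \<oplus> g w) w = shuffle_br A h f w \<oplus> shuffle_br A h g w"
  using assms by (simp add: shuffle_br_anti[of _ h] shuffle_br_add_left smul_add_right)

lemma shuffle_br_smul_right:
  assumes "\<And>w. f w \<in> carrier A" "\<And>w. g w \<in> carrier A"
  shows "shuffle_br A f (\<lambda>w. c \<odot> g w) w = c \<odot> shuffle_br A f g w"
  using assms shuffle_br_anti[of "\<lambda>w. c \<odot> g w" f w] shuffle_br_anti[of g f w]
    smul_mult[of "shuffle_br A g f w" "- 1" c] smul_mult[of "shuffle_br A g f w" c "- 1"]
  by (simp add: shuffle_br_smul_left)

lemma shuffle_br_zero_right [simp]:
  "(\<And>w. f w \<in> carrier A) \<Longrightarrow> shuffle_br A f (\<lambda>w. \<zero>) w = \<zero>"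
  by (induction w arbitrary: f) simp_all

lemma shuffle_br_zero_left [simp]:
  "(\<And>w. f w \<in> carrier A) \<Longrightarrow> shuffle_br A (\<lambda>w. \<zero>) f w = \<zero>"
  by (induction w arbitrary: f) simp_all

text \<open>The Leibniz rule, applied twice, yields nine terms. They regroup into three Jacobi sums
  for the shorter list, according to whether the derivative falls on \<open>f\<close>,
  \<open>g\<close> or \<open>h\<close>.\<close>

lemma shuffle_br_jacobi:
  "\<lbrakk>\<And>w. f w \<in> carrier A; \<And>w. g w \<in> carrier A; \<And>w. h w \<in> carrier A\<rbrakk>
    \<Longrightarrow> shuffle_br A f (shuffle_br A g h) w \<oplus> shuffle_br A g (shuffle_br A h f) w
        \<oplus> shuffle_br A h (shuffle_br A f g) w = \<zero>"
proof (induction w arbitrary: f g h)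
  case Nil
  then show ?case by (simp add: jacobi)
next
  case (Cons v w)
  have rearrange: "(a1 \<oplus> (a2 \<oplus> a3)) \<oplus> (b1 \<oplus> (b2 \<oplus> b3)) \<oplus> (c1 \<oplus> (c2 \<oplus> c3))
      = (a1 \<oplus> b3 \<oplus> c2) \<oplus> (a2 \<oplus> b1 \<oplus> c3) \<oplus> (a3 \<oplus> b2 \<oplus> c1)"
    if "a1 \<in> carrier A" "a2 \<in> carrier A" "a3 \<in> carrier A" "b1 \<in> carrier A" "b2 \<in> carrier A"
      "b3 \<in> carrier A" "c1 \<in> carrier A" "c2 \<in> carrier A" "c3 \<in> carrier A"
    for a1 a2 a3 b1 b2 b3 c1 c2 c3
    using that by (simp add: add_ac)
  have step: "shuffle_br A p (shuffle_br A q r) (v # w) = shuffle_br A (pd v p) (shuffle_br A q r) w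
      \<oplus> (shuffle_br A p (shuffle_br A (pd v q) r) w \<oplus> shuffle_br A p (shuffle_br A q (pd v r)) w)"
    if "\<And>w. p w \<in> carrier A" "\<And>w. q w \<in> carrier A" "\<And>w. r w \<in> carrier A" for p q r
    using that by (simp add: shuffle_br_add_right)
  show ?case
    unfolding step[OF Cons.prems] step[OF Cons.prems(2,3,1)] step[OF Cons.prems(3,1,2)]
    by (subst rearrange)
      (use Cons.prems Cons.IH[of "pd v f" g h] Cons.IH[of f "pd v g" h] Cons.IH[of f g "pd v h"]
        in simp_all)
qed

lemma lie_algebra_fun_alg: "lie_algebra (fun_alg A :: ('k, 'v list \<Rightarrow> 'a) lie_alg)"
proof (rule lie_algebra.intro, goal_cases)
  case (6 f g)
  then show ?case by (simp add: fun_eq_iff add_comm)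
next
  case (8 f)
  then show ?case by (intro bexI[of _ "\<lambda>w. (- 1) \<odot> f w"]) simp_all
next
  case (18 f g h)
  then show ?case by (simp add: fun_eq_iff shuffle_br_jacobi)
qed (simp_all add: fun_eq_iff add_assoc smul_add_left smul_add_right smul_mult
    shuffle_br_add_left shuffle_br_add_right shuffle_br_smul_left shuffle_br_smul_right
    shuffle_br_self)

end

section \<open>Symmetric multilinear functions and the derivation \<open>s\<close>\<close>

text \<open>Symmetry is what makes the derivations \<open>pd v\<close> commute.\<close>

definition sym_multilinear :: "('k::comm_ring_1, 'a) lie_alg \<Rightarrow> ('k poly list \<Rightarrow> 'a) set" where
  "sym_multilinear A = {f. (\<forall>w. f w \<in> carrier A) \<and>
     (\<forall>u x y w. f (u @ x # y # w) = f (u @ y # x # w)) \<and>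
     (\<forall>u x y w. f (u @ (x + y) # w) = add A (f (u @ x # w)) (f (u @ y # w))) \<and>
     (\<forall>u c x w. f (u @ smult c x # w) = smul A c (f (u @ x # w)))}"

lemma sym_multilinearD:
  assumes "f \<in> sym_multilinear A"
  shows "f w \<in> carrier A" and "f (u @ x # y # w) = f (u @ y # x # w)"
    and "f (u @ (x + y) # w) = add A (f (u @ x # w)) (f (u @ y # w))"
    and "f (u @ smult c x # w) = smul A c (f (u @ x # w))"
  using assms unfolding sym_multilinear_def by blast+

lemma sym_multilinear_pd: "f \<in> sym_multilinear A \<Longrightarrow> pd v f \<in> sym_multilinear A"
  using sym_multilinearD(1)[of f A] sym_multilinearD(2-4)[of f A "v # _"]
  by (simp add: sym_multilinear_def)

lemma sym_multilinear_hd: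
  assumes "f \<in> sym_multilinear A"
  shows "f (x # y # w) = f (y # x # w)" and "f ((x + y) # w) = add A (f (x # w)) (f (y # w))"
    and "f (smult c x # w) = smul A c (f (x # w))"
  using sym_multilinearD(2-4)[OF assms, of "[]"] by simp_all

text \<open>The derivation \<open>s\<close>; its recursion says \<open>[pd v, s] = pd (X v)\<close>.\<close>

primrec shift :: "('k::comm_ring_1, 'a) lie_alg \<Rightarrow> ('k poly list \<Rightarrow> 'a) \<Rightarrow> 'k poly list \<Rightarrow> 'a" where
  "shift A f [] = zero A"
| "shift A f (v # w) = add A (f (pCons 0 v # w)) (shift A (pd v f) w)"

context lie_algebra
begin

text \<open>Induction on the prefix \<open>u\<close>: the Leibniz rule moves a leading entry into
  one factor as a partial derivative, which is again symmetric multilinear. Only changes at the head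
  of the list remain to be checked.\<close>

lemma lie_subalgebra_sym_multilinear: "lie_subalgebra (fun_alg A) (sym_multilinear A)"
proof -
  have swap: "shuffle_br A f g (u @ x # y # w) = shuffle_br A f g (u @ y # x # w)"
    if "f \<in> sym_multilinear A" "g \<in> sym_multilinear A" for f g u x y w
    using that
  proof (induction u arbitrary: f g)
    case Nil
    have "pd x (pd y f) = pd y (pd x f)" "pd x (pd y g) = pd y (pd x g)"
      using Nil by (simp_all add: sym_multilinear_hd(1)[where x = x])
    then show ?case
      using Nil by (simp add: sym_multilinearD(1) add_ac)
  next
    case (Cons v u)
    then show ?case
      using Cons.IH[of "pd v f" g] Cons.IH[of f "pd v g"] by (simp add: sym_multilinear_pd)
  qed
  have additive: "shuffle_br A f g (u @ (x + y) # w) =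
      shuffle_br A f g (u @ x # w) \<oplus> shuffle_br A f g (u @ y # w)"
    if "f \<in> sym_multilinear A" "g \<in> sym_multilinear A" for f g u x y w
    using that
  proof (induction u arbitrary: f g)
    case Nil
    then show ?case
      by (simp add: sym_multilinear_hd(2) sym_multilinearD(1) shuffle_br_add_left
          shuffle_br_add_right add_swap)
  next
    case (Cons v u)
    then show ?case
      using Cons.IH[of "pd v f" g] Cons.IH[of f "pd v g"]
      by (simp add: sym_multilinear_pd sym_multilinearD(1) add_swap)
  qed
  have homogeneous: "shuffle_br A f g (u @ smult c x # w) = c \<odot> shuffle_br A f g (u @ x # w)"
    if "f \<in> sym_multilinear A" "g \<in> sym_multilinear A" for f g u c x w
    using that
  proof (induction u arbitrary: f g)
    case Nil
    then show ?case
      by (simp add: sym_multilinear_hd(3) sym_multilinearD(1) shuffle_br_smul_left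
          shuffle_br_smul_right smul_add_right)
  next
    case (Cons v u)
    then show ?case
      using Cons.IH[of "pd v f" g] Cons.IH[of f "pd v g"]
      by (simp add: sym_multilinear_pd sym_multilinearD(1) smul_add_right)
  qed
  have "f w \<in> carrier A" if "f \<in> sym_multilinear A" for f w
    using sym_multilinearD(1)[OF that] .
  moreover have "(\<lambda>w. f w \<oplus> g w) \<in> sym_multilinear A"
    if "f \<in> sym_multilinear A" "g \<in> sym_multilinear A" for f g
    using sym_multilinearD[OF that(1)] sym_multilinearD[OF that(2)]
    unfolding sym_multilinear_def by (simp add: smul_add_right add_swap)
  moreover have "(\<lambda>w. c \<odot> f w) \<in> sym_multilinear A" if "f \<in> sym_multilinear A" for c f
    using sym_multilinearD[OF that]
    unfolding sym_multilinear_def by (simp add: smul_add_right mult.commute flip: smul_mult)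
  moreover have "shuffle_br A f g \<in> sym_multilinear A"
    if "f \<in> sym_multilinear A" "g \<in> sym_multilinear A" for f g
    using that swap additive homogeneous unfolding sym_multilinear_def by simp
  moreover have "(\<lambda>w. \<zero>) \<in> sym_multilinear A"
    by (simp add: sym_multilinear_def)
  ultimately show ?thesis
    by (simp add: lie_subalgebra_def subset_iff)
qed

lemma shift_closed [simp]: "(\<And>w. f w \<in> carrier A) \<Longrightarrow> shift A f w \<in> carrier A"
  by (induction w arbitrary: f) simp_all

lemma shift_add:
  "\<lbrakk>\<And>w. f w \<in> carrier A; \<And>w. g w \<in> carrier A\<rbrakk>
    \<Longrightarrow> shift A (\<lambda>w. f w \<oplus> g w) w = shift A f w \<oplus> shift A g w"
  by (induction w arbitrary: f g) (simp_all add: add_swap)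

lemma shift_smul:
  "(\<And>w. f w \<in> carrier A) \<Longrightarrow> shift A (\<lambda>w. c \<odot> f w) w = c \<odot> shift A f w"
  by (induction w arbitrary: f) (simp_all add: smul_add_right)

text \<open>After taking \<open>pd v\<close> and using \<open>[pd v, s] = pd (X v)\<close>, what is
  left besides the induction hypotheses is the Leibniz rule for \<open>pd (X v)\<close>, which is
  the recursion of \<open>shuffle_br\<close>.\<close>

lemma shift_shuffle_br:
  "\<lbrakk>\<And>w. f w \<in> carrier A; \<And>w. g w \<in> carrier A\<rbrakk>
    \<Longrightarrow> shift A (shuffle_br A f g) w = shuffle_br A (shift A f) g w \<oplus> shuffle_br A f (shift A g) w"
proof (induction w arbitrary: f g)
  case (Cons v w)
  then show ?case
    using Cons.IH[of "pd v f" g] Cons.IH[of f "pd v g"]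
    by (simp add: shift_add shuffle_br_add_left shuffle_br_add_right) (simp add: add_ac)
qed simp

lemma shift_sym_multilinear:
  assumes "f \<in> sym_multilinear A" shows "shift A f \<in> sym_multilinear A"
proof -
  have swap: "shift A f (u @ x # y # w) = shift A f (u @ y # x # w)"
    if "f \<in> sym_multilinear A" for f u x y w
    using that
  proof (induction u arbitrary: f)
    case Nil
    have "pd x (pd y f) = pd y (pd x f)"
      by (rule ext) (rule sym_multilinear_hd(1)[OF Nil])
    \<comment> \<open>The two terms in which one of the swapped entries carries the factor
      \<open>X\<close> are matched by the symmetry of \<open>f\<close>.\<close>
    moreover have "f (pCons 0 x # y # w) = f (y # pCons 0 x # w)"
      "f (pCons 0 y # x # w) = f (x # pCons 0 y # w)"
      by (rule sym_multilinear_hd(1)[OF Nil])+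
    ultimately show ?case
      using Nil by (simp add: sym_multilinearD(1) add_ac)
  next
    case (Cons v u)
    then show ?case
      using Cons.IH[of "pd v f"] sym_multilinearD(2)[OF Cons.prems, of "pCons 0 v # u" x]
      by (simp add: sym_multilinear_pd)
  qed
  have additive: "shift A f (u @ (x + y) # w) = shift A f (u @ x # w) \<oplus> shift A f (u @ y # w)"
    if "f \<in> sym_multilinear A" for f u x y w
    using that
  proof (induction u arbitrary: f)
    case Nil
    have "pCons 0 (x + y) = pCons 0 x + pCons 0 y" by simp
    then show ?case
      using Nil by (simp add: sym_multilinear_hd(2) sym_multilinearD(1) shift_add add_swap del: add_pCons)
  next
    case (Cons v u)
    then show ?case
      using Cons.IH[of "pd v f"] sym_multilinearD(3)[OF Cons.prems, of "pCons 0 v # u"]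
      by (simp add: sym_multilinear_pd sym_multilinearD(1) add_swap)
  qed
  have homogeneous: "shift A f (u @ smult c x # w) = c \<odot> shift A f (u @ x # w)"
    if "f \<in> sym_multilinear A" for f u c x w
    using that
  proof (induction u arbitrary: f)
    case Nil
    have "pCons 0 (smult c x) = smult c (pCons 0 x)" by simp
    then show ?case
      using Nil by (simp add: sym_multilinear_hd(3) sym_multilinearD(1) shift_smul smul_add_right del: smult_pCons)
  next
    case (Cons v u)
    then show ?case
      using Cons.IH[of "pd v f"] sym_multilinearD(4)[OF Cons.prems, of "pCons 0 v # u"]
      by (simp add: sym_multilinear_pd sym_multilinearD(1) smul_add_right)
  qed
  show ?thesis
    using assms swap additive homogeneous sym_multilinearD(1)[OF assms]
    unfolding sym_multilinear_def by simp
qed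

end

section \<open>The Lie algebra of derivations \<open>pd v + l s\<close> and its action\<close>

definition sym_alg :: "('k::comm_ring_1, 'a) lie_alg \<Rightarrow> ('k, 'k poly list \<Rightarrow> 'a) lie_alg" where
  "sym_alg A = (fun_alg A)\<lparr>carrier := sym_multilinear A\<rparr>"

lemma sym_alg_simps [simp]:
  "carrier (sym_alg A) = sym_multilinear A"
  "add (sym_alg A) f g = (\<lambda>w. add A (f w) (g w))"
  "zero (sym_alg A) = (\<lambda>w. zero A)"
  "smul (sym_alg A) c f = (\<lambda>w. smul A c (f w))"
  "br (sym_alg A) = shuffle_br A"
  by (simp_all add: sym_alg_def)

text \<open>The pair \<open>(v, l)\<close> stands for the derivation \<open>pd v + l s\<close>.\<close>

definition shift_alg :: "('k::comm_ring_1, 'k poly \<times> 'k) lie_alg" where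
  "shift_alg = \<lparr>carrier = UNIV, add = (\<lambda>(v, l) (w, m). (v + w, l + m)), zero = (0, 0),
     smul = (\<lambda>c (v, l). (smult c v, c * l)),
     br = (\<lambda>(v, l) (w, m). (smult m (pCons 0 v) - smult l (pCons 0 w), 0))\<rparr>"

lemma shift_alg_simps [simp]:
  "carrier shift_alg = UNIV"
  "add shift_alg (v, l) (w, m) = (v + w, l + m)"
  "zero shift_alg = (0, 0)"
  "smul shift_alg c (v, l) = (smult c v, c * l)"
  "br shift_alg (v, l) (w, m) = (smult m (pCons 0 v) - smult l (pCons 0 w), 0)"
  by (simp_all add: shift_alg_def)

lemma lie_algebra_shift_alg: "lie_algebra (shift_alg :: ('k::comm_ring_1, 'k poly \<times> 'k) lie_alg)"
proof (rule lie_algebra.intro, goal_cases)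
  case (8 e)
  obtain v l where "e = (v, l)" by (cases e)
  then show ?case by (intro bexI[of _ "(- v, - l)"]) simp_all
qed (auto simp: algebra_simps smult_add_left smult_add_right smult_diff_right)

definition shift_act :: "('k::comm_ring_1, 'a) lie_alg \<Rightarrow> 'k poly \<times> 'k \<Rightarrow>
    ('k poly list \<Rightarrow> 'a) \<Rightarrow> 'k poly list \<Rightarrow> 'a" where
  "shift_act A e f = (\<lambda>w. add A (f (fst e # w)) (smul A (snd e) (shift A f w)))"

context lie_algebra
begin

lemma lie_algebra_sym_alg: "lie_algebra (sym_alg A)"
  unfolding sym_alg_def
  by (rule lie_algebra.lie_algebra_subalgebra[OF lie_algebra_fun_alg lie_subalgebra_sym_multilinear])

lemma add_cancel_common:
  assumes "x \<in> carrier A" "y \<in> carrier A" "z \<in> carrier A"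
  shows "(x \<oplus> z) \<oplus> (- 1) \<odot> (y \<oplus> z) = x \<oplus> (- 1) \<odot> y"
proof -
  have "(x \<oplus> z) \<oplus> (- 1) \<odot> (y \<oplus> z) = (x \<oplus> (- 1) \<odot> y) \<oplus> (z \<oplus> (- 1) \<odot> z)"
    using assms by (simp add: smul_add_right add_ac del: add_neg neg_add add_neg_cancel)
  then show ?thesis using assms by simp
qed

lemma sym_multilinear_zero:
  assumes "f \<in> sym_multilinear A" shows "f (0 # w) = \<zero>"
  using sym_multilinear_hd(3)[OF assms, of 0 0 w] sym_multilinearD(1)[OF assms] by simp

lemma sym_multilinear_diff:
  assumes "f \<in> sym_multilinear A"
  shows "f ((x - y) # w) = f (x # w) \<oplus> (- 1) \<odot> f (y # w)"
  using sym_multilinear_hd(2)[OF assms, of x "smult (- 1) y" w]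
    sym_multilinear_hd(3)[OF assms, of "- 1" y w] by simp

lemma shift_act_commutator:
  assumes f: "f \<in> sym_multilinear A"
  shows "shift_act A (br shift_alg (v, l) (v', m)) f w =
    shift_act A (v, l) (shift_act A (v', m) f) w
      \<oplus> (- 1) \<odot> shift_act A (v', m) (shift_act A (v, l) f) w"
proof -
  note [simp] = sym_multilinearD(1)[OF f]
  \<comment> \<open>The part common to both orders of composition; collecting it uses the symmetry
    of \<open>f\<close> for \<open>pd v\<close> and \<open>pd v'\<close>. The leftover terms come
    from \<open>[pd v, s] = pd (X v)\<close>.\<close>
  define z where "z = f (v # v' # w) \<oplus> (m \<odot> shift A (pd v f) w \<oplus>
    (l \<odot> shift A (pd v' f) w \<oplus> (l * m) \<odot> shift A (shift A f) w))"
  have "shift_act A (v, l) (shift_act A (v', m) f) w = m \<odot> f (pCons 0 v # w) \<oplus> z"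
    unfolding z_def shift_act_def
    by (simp add: shift_add shift_smul smul_add_right smul_mult sym_multilinear_hd(1)[OF f, of v' v])
      (simp add: add_ac)
  moreover have "shift_act A (v', m) (shift_act A (v, l) f) w = l \<odot> f (pCons 0 v' # w) \<oplus> z"
    unfolding z_def shift_act_def
    by (simp add: shift_add shift_smul smul_add_right smul_mult mult.commute[of l m])
      (simp add: add_ac)
  moreover have "shift_act A (br shift_alg (v, l) (v', m)) f w
      = m \<odot> f (pCons 0 v # w) \<oplus> (- 1) \<odot> l \<odot> f (pCons 0 v' # w)"
    by (simp add: shift_act_def sym_multilinear_diff[OF f] sym_multilinear_hd(3)[OF f]
        del: smult_pCons)
  moreover have "z \<in> carrier A" by (simp add: z_def)
  ultimately show ?thesis by (simp add: add_cancel_common)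
qed

lemma shift_act_closed:
  assumes "f \<in> sym_multilinear A" shows "shift_act A e f \<in> sym_multilinear A"
proof -
  interpret S: lie_algebra "sym_alg A" by (rule lie_algebra_sym_alg)
  show ?thesis
    using S.add_closed[of "pd (fst e) f" "smul (sym_alg A) (snd e) (shift A f)"]
      S.smul_closed[of "shift A f" "snd e"] assms
    by (simp add: shift_act_def sym_multilinear_pd shift_sym_multilinear)
qed

lemma lie_action_shift: "lie_action (sym_alg A) shift_alg (shift_act A)"
proof (intro lie_action.intro lie_action_axioms.intro lie_algebra_sym_alg lie_algebra_shift_alg,
    goal_cases)
  case (1 e f)
  then show ?case by (simp add: shift_act_closed)
next
  case (2 e f g)
  then show ?case
    by (simp add: shift_act_def fun_eq_iff sym_multilinearD(1) shift_add smul_add_right add_swap)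
next
  case (3 e c f)
  then show ?case
    by (simp add: shift_act_def fun_eq_iff sym_multilinearD(1) shift_smul smul_add_right
        mult.commute flip: smul_mult)
next
  case (4 e d f)
  then show ?case
    by (cases e; cases d)
      (simp add: shift_act_def fun_eq_iff sym_multilinearD(1) smul_add_left sym_multilinear_hd(2) add_swap)
next
  case (5 c e f)
  then show ?case
    by (cases e)
      (simp add: shift_act_def fun_eq_iff sym_multilinearD(1) smul_mult smul_add_right sym_multilinear_hd(3))
next
  case (6 e f g)
  then have [simp]: "f w \<in> carrier A" "g w \<in> carrier A" for w
    by (simp_all add: sym_multilinearD(1))
  show ?case
    by (simp add: shift_act_def fun_eq_iff shift_shuffle_br shuffle_br_add_left
        shuffle_br_add_right shuffle_br_smul_left shuffle_br_smul_right smul_add_right add_swap)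
next
  case (7 e d f)
  then show ?case
    by (cases e; cases d) (simp only: fun_eq_iff sym_alg_simps shift_act_commutator, simp)
qed

end

section \<open>The two generators\<close>

primrec lsum :: "('k, 'a) lie_alg \<Rightarrow> (nat \<Rightarrow> 'a) \<Rightarrow> nat \<Rightarrow> 'a" where
  "lsum A t 0 = zero A"
| "lsum A t (Suc n) = add A (lsum A t n) (t n)"

text \<open>The linear form with \<open>X\<^bsup>2 i + 2\<^esup> \<mapsto> x\<^sub>i\<close> that vanishes on all other powers of \<open>X\<close>. Only even
  powers are used so that \<open>quad\<close> below is symmetric, and \<open>X\<^sup>0\<close> is skipped because \<open>\<partial>\<^sub>0\<close> itself is not
  available as an element of the generated subalgebra.\<close>

definition even_form :: "('k::comm_ring_1, 'a) lie_alg \<Rightarrow> (nat \<Rightarrow> 'a) \<Rightarrow> 'k poly \<Rightarrow> 'a" where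
  "even_form A x p = lsum A (\<lambda>i. smul A (coeff p (2 * i + 2)) (x i)) (degree p)"

text \<open>Multiplying \<open>u\<close> or \<open>v\<close> by \<open>X\<close> multiplies \<open>u(-X) v(X)\<close> by \<open>-X\<close> or \<open>X\<close> respectively, so \<open>shift\<close>
  annihilates this form.\<close>

definition quad :: "('k::comm_ring_1, 'a) lie_alg \<Rightarrow> (nat \<Rightarrow> 'a) \<Rightarrow> 'k poly list \<Rightarrow> 'a" where
  "quad A x w = (case w of [u, v] \<Rightarrow> even_form A x (pcompose u [:0, - 1:] * v) | _ \<Rightarrow> zero A)"

definition const_fun :: "('k, 'a) lie_alg \<Rightarrow> 'a \<Rightarrow> 'v list \<Rightarrow> 'a" where
  "const_fun A x w = (if w = [] then x else zero A)"

lemma const_fun_simps [simp]: "const_fun A x [] = x" "const_fun A x (v # w) = zero A"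
  by (simp_all add: const_fun_def)

abbreviation big_alg where "big_alg A \<equiv> semidirect (sym_alg A) shift_alg (shift_act A)"

definition const_embed :: "('k::comm_ring_1, 'a) lie_alg \<Rightarrow> 'a \<Rightarrow> ('k poly list \<Rightarrow> 'a) \<times> 'k poly \<times> 'k" where
  "const_embed A x = (const_fun A x, 0, 0)"

context lie_algebra
begin

lemma lsum_closed [simp]: "(\<And>i. t i \<in> carrier A) \<Longrightarrow> lsum A t n \<in> carrier A"
  by (induction n) simp_all

lemma lsum_add:
  "\<lbrakk>\<And>i. t i \<in> carrier A; \<And>i. u i \<in> carrier A\<rbrakk>
    \<Longrightarrow> lsum A (\<lambda>i. t i \<oplus> u i) n = lsum A t n \<oplus> lsum A u n"
  by (induction n) (simp_all add: add_swap)

lemma lsum_smul: "(\<And>i. t i \<in> carrier A) \<Longrightarrow> lsum A (\<lambda>i. c \<odot> t i) n = c \<odot> lsum A t n"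
  by (induction n) (simp_all add: smul_add_right)

lemma lsum_extend:
  assumes "\<And>i. t i \<in> carrier A" "\<And>i. m \<le> i \<Longrightarrow> t i = \<zero>" "m \<le> n"
  shows "lsum A t n = lsum A t m"
  using assms(3) by (induction rule: dec_induct) (simp_all add: assms)

section \<open>The quadratic series \<open>a\<close>\<close>

context
  fixes x :: "nat \<Rightarrow> 'a"
  assumes x [simp]: "x i \<in> carrier A"
begin

lemma even_form_closed [simp]: "even_form A x p \<in> carrier A"
  by (simp add: even_form_def)

text \<open>For \<open>i\<close> at least \<open>degree p\<close> the index \<open>2 * i + 2\<close>
  exceeds the degree, so longer sums only add zeros. Several polynomials can thus be summed over one
  common range.\<close>

lemma even_form_eq:
  "degree p \<le> n \<Longrightarrow> even_form A x p = lsum A (\<lambda>i. coeff p (2 * i + 2) \<odot> x i) n"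
  unfolding even_form_def by (rule lsum_extend[symmetric]) (simp_all add: coeff_eq_0)

lemma even_form_add: "even_form A x (p + q) = even_form A x p \<oplus> even_form A x q"
proof -
  define n where "n = max (degree p) (degree q)"
  have "degree p \<le> n" "degree q \<le> n" "degree (p + q) \<le> n"
    by (simp_all add: n_def degree_add_le_max)
  then show ?thesis by (simp add: even_form_eq[of _ n] smul_add_left lsum_add)
qed

lemma even_form_smult: "even_form A x (smult c p) = c \<odot> even_form A x p"
  by (simp add: even_form_eq[of _ "degree p"] degree_smult_le smul_mult lsum_smul)

lemma even_form_zero [simp]: "even_form A x 0 = \<zero>"
  by (simp add: even_form_def)

text \<open>Substituting \<open>-X\<close> multiplies the coefficient of \<open>X^n\<close> by
  \<open>(-1)^n\<close>, and the form reads only even \<open>n\<close>.\<close>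

lemma even_form_reflect: "even_form A x (pcompose p [:0, - 1:]) = even_form A x p"
proof -
  define n where "n = max (degree p) (degree (pcompose p [:0, - 1:]))"
  have "degree p \<le> n" "degree (pcompose p [:0, - 1:]) \<le> n" by (simp_all add: n_def)
  then show ?thesis by (simp add: even_form_eq[of _ n] coeff_pcompose_linear)
qed

lemma even_form_monom: "even_form A x (monom c (2 * i + 2)) = c \<odot> x i"
proof -
  have "even_form A x (monom c (2 * i + 2)) =
      lsum A (\<lambda>j. coeff (monom c (2 * i + 2)) (2 * j + 2) \<odot> x j) (2 * i + 2)"
    by (rule even_form_eq) (rule degree_monom_le)
  also have "\<dots> = lsum A (\<lambda>j. (if i = j then c else 0) \<odot> x j) (2 * i + 2)"
    by (simp add: coeff_monom)
  also have "\<dots> = lsum A (\<lambda>j. (if i = j then c else 0) \<odot> x j) (Suc i)"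
    by (rule lsum_extend) auto
  also have "\<dots> = c \<odot> x i"
  proof -
    have "lsum A (\<lambda>j. (if i = j then c else 0) \<odot> x j) k = \<zero>" if "k \<le> i" for k
      using that by (induction k) auto
    then show ?thesis by simp
  qed
  finally show ?thesis .
qed

lemma quad_sym_multilinear: "quad A x \<in> sym_multilinear A"
proof -
  \<comment> \<open>The substitution of \<open>-X\<close> for \<open>X\<close> exchanges
    \<open>u(-X) v(X)\<close> and \<open>v(-X) u(X)\<close>.\<close>
  have swap: "even_form A x (pcompose u [:0, - 1:] * v) = even_form A x (pcompose v [:0, - 1:] * u)" for u v
  proof -
    have "pcompose (pcompose v [:0, - 1:]) [:0, - 1:] = v"
      by (simp add: pcompose_pCons flip: pcompose_assoc)
    then have "pcompose u [:0, - 1:] * v = pcompose (pcompose v [:0, - 1:] * u) [:0, - 1:]"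
      by (simp add: pcompose_mult mult.commute)
    then show ?thesis by (simp only: even_form_reflect)
  qed
  show ?thesis
    unfolding sym_multilinear_def
  proof (intro CollectI conjI allI)
    fix w show "quad A x w \<in> carrier A"
      by (simp add: quad_def split: list.split)
  next
    fix u y z w
    show "quad A x (u @ y # z # w) = quad A x (u @ z # y # w)"
      by (cases u; cases w) (auto simp: quad_def swap[of y] split: list.split)
  next
    fix u y z w
    show "quad A x (u @ (y + z) # w) = quad A x (u @ y # w) \<oplus> quad A x (u @ z # w)"
      by (cases u; cases w)
        (auto simp: quad_def pcompose_add ring_distribs even_form_add split: list.split)
  next
    fix u c y w
    show "quad A x (u @ smult c y # w) = c \<odot> quad A x (u @ y # w)"
      by (cases u; cases w)
        (auto simp: quad_def pcompose_smult even_form_smult split: list.split)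
  qed
qed

lemma shift_quad: "shift A (quad A x) w = \<zero>"
proof -
  have zero: "shift A (\<lambda>w. \<zero>) w = \<zero>" for w
    by (induction w) simp_all
  have cancel: "even_form A x (pcompose (pCons 0 u) [:0, - 1:] * v)
      \<oplus> even_form A x (pCons 0 (pcompose u [:0, - 1:] * v)) = \<zero>" for u v
    by (simp add: pcompose_pCons flip: even_form_add)
  \<comment> \<open>\<open>shift\<close> evaluates its argument only at lists of the same length, so
    lists of length two are the only nontrivial case; there \<open>X\<close> is put on either entry
    in turn and \<open>cancel\<close> applies.\<close>
  consider "w = []" | u where "w = [u]" | u v where "w = [u, v]" | u v y z where "w = u # v # y # z"
    by (metis list.exhaust)
  then show ?thesis
    by cases (simp_all add: quad_def cancel zero)
qed

end

section \<open>Constant series and the embedding of \<open>A\<close>\<close>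

lemma const_fun_closed [simp]: "x \<in> carrier A \<Longrightarrow> const_fun A x w \<in> carrier A"
  by (simp add: const_fun_def)

lemma const_fun_sym_multilinear: "x \<in> carrier A \<Longrightarrow> const_fun A x \<in> sym_multilinear A"
  by (simp add: sym_multilinear_def const_fun_def)

lemma shuffle_br_const_fun:
  assumes "x \<in> carrier A" "y \<in> carrier A"
  shows "shuffle_br A (const_fun A x) (const_fun A y) = const_fun A \<lbrace>x, y\<rbrace>"
proof
  show "shuffle_br A (const_fun A x) (const_fun A y) w = const_fun A \<lbrace>x, y\<rbrace> w" for w
    using assms by (cases w) simp_all
qed

lemma shift_act_zero [simp]: "f \<in> sym_multilinear A \<Longrightarrow> shift_act A (0, 0) f = (\<lambda>w. \<zero>)"
  by (simp add: shift_act_def sym_multilinear_zero sym_multilinearD(1))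

lemma lie_hom_const_embed: "lie_hom A (big_alg A) (const_embed A)"
  unfolding lie_hom_def
  by (simp add: const_embed_def const_fun_sym_multilinear shuffle_br_const_fun)
    (auto simp: const_fun_def fun_eq_iff)

lemma const_embed_zero: "const_embed A \<zero> = zero (big_alg A)"
  by (simp add: const_embed_def const_fun_def fun_eq_iff)

lemma inj_on_const_embed: "inj_on (const_embed A) (carrier A)"
  by (rule inj_onI) (metis const_embed_def const_fun_simps(1) prod.inject)

lemma lie_algebra_big_alg: "lie_algebra (big_alg A)"
  by (rule lie_action.lie_algebra_semidirect[OF lie_action_shift])

text \<open>The two given members of \<open>M\<close> are \<open>s\<close> and
  \<open>q = pd 1 + a\<close>, where the polynomial \<open>1\<close> is \<open>X^0\<close>. Brackets
  with \<open>s\<close> produce the higher partial derivatives, and two of these applied to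
  \<open>a\<close> leave a constant.\<close>

lemma const_embed_generators:
  fixes x :: "nat \<Rightarrow> 'a"
  assumes x: "\<And>i. x i \<in> carrier A"
    and M: "lie_subalgebra (big_alg A) M"
    and P: "((\<lambda>w. \<zero>), 0, 1) \<in> M"
    and Q: "(quad A x, 1, 0) \<in> M"
  shows "const_embed A (x i) \<in> M"
proof -
  interpret S: lie_algebra "sym_alg A" by (rule lie_algebra_sym_alg)
  have zero_sym [simp]: "(\<lambda>w. \<zero>) \<in> sym_multilinear A" using S.zero_closed by simp
  note quad [simp] = quad_sym_multilinear[of x, OF x]
  have quad_closed [simp]: "quad A x w \<in> carrier A" for w
    by (rule sym_multilinearD(1)[OF quad])
  have br: "br (big_alg A) X Y \<in> M" if "X \<in> M" "Y \<in> M" for X Y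
    using M that by (simp add: lie_subalgebra_def)
  have shift_zero [simp]: "shift A (\<lambda>w. \<zero>) w = \<zero>" for w
    by (induction w) simp_all
  \<comment> \<open>\<open>[q, s] = pd X\<close>, because the series part \<open>- s a\<close>
    vanishes; each further bracket with \<open>s\<close> multiplies by \<open>X\<close>. Exponents
    therefore start at 1.\<close>
  have D: "((\<lambda>w. \<zero>), monom 1 (Suc n), 0) \<in> M" for n
  proof (induction n)
    case 0
    show ?case
      using br[OF Q P]
      by (simp add: shift_act_def shift_quad[of x, OF x] sym_multilinear_zero[OF quad] monom_Suc
          one_pCons)
  next
    case (Suc n)
    show ?case
      using br[OF Suc P] by (simp add: shift_act_def monom_Suc)
  qed
  \<comment> \<open>Partial derivatives commute, so bracketing \<open>pd X\<close> with
    \<open>q\<close> removes the summand \<open>pd 1\<close> and leaves a pure series.\<close>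
  have "(\<lambda>w. quad A x (monom 1 1 # w), 0, 0) \<in> M"
    using br[OF D[of 0] Q] by (simp add: shift_act_def)
  from br[OF D[of "2 * i"] this]
  have "(\<lambda>w. quad A x (monom 1 1 # monom 1 (Suc (2 * i)) # w), 0, 0) \<in> M"
    by (simp add: shift_act_def)
  \<comment> \<open>The exponents 1 and \<open>2 * i + 1\<close> add up to the index at which
    \<open>even_form\<close> reads off \<open>x i\<close>. Reflecting the first factor
    \<open>X\<close> causes the sign, undone below by scaling with \<open>- 1\<close>.\<close>
  moreover have "pcompose (monom 1 1) [:0, - 1:] * monom 1 (Suc (2 * i)) = monom (- 1 :: 'k) (2 * i + 2)"
    by (simp add: monom_Suc pcompose_pCons monom_0 minus_monom)
  then have "(\<lambda>w. quad A x (monom 1 1 # monom 1 (Suc (2 * i)) # w)) = const_fun A ((- 1) \<odot> x i)"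
    using even_form_monom[of x "- 1" i, OF x] x
    by (auto simp: fun_eq_iff quad_def const_fun_def split: list.split)
  ultimately have "(const_fun A ((- 1) \<odot> x i), 0, 0) \<in> M" by simp
  then have "smul (big_alg A) (- 1) (const_fun A ((- 1) \<odot> x i), 0, 0) \<in> M"
    using M by (simp only: lie_subalgebra_def)
  moreover have "(\<lambda>w :: 'k poly list. (- 1) \<odot> const_fun A ((- 1) \<odot> x i) w) = const_fun A (x i)"
    using x by (auto simp: const_fun_def)
  ultimately show ?thesis by (simp add: const_embed_def)
qed

end

theorem theorem4p10:
  fixes phi :: "'f::field \<Rightarrow> 'k::comm_ring_1"
    and A :: "('k, 'a) lie_alg"
    and S :: "'a set"
  assumes "alg_structure_map phi"
    and "is_lie_algebra A"
    and "S \<subseteq> carrier A" and "countable S" and "lie_span A S = carrier A"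
  shows "\<exists>(B :: ('k, nat \<times> 'k) lie_alg) f.
           is_lie_algebra B \<and> lie_hom A B f \<and> inj_on f (carrier A) \<and>
           (\<exists>x\<in>carrier B. \<exists>y\<in>carrier B. lie_span B {x, y} = carrier B)"
proof -
  interpret lie_algebra A using assms(2) by (simp add: lie_algebra_iff)
  interpret W: lie_algebra "big_alg A" by (rule lie_algebra_big_alg)
  \<comment> \<open>Inserting \<open>\<zero>\<close> makes the set nonempty, so a sequence, possibly
    with repetitions, enumerates it even if \<open>S\<close> is finite or empty.\<close>
  define x where "x = from_nat_into (insert \<zero> S)"
  have range_x: "range x = insert \<zero> S"
    unfolding x_def by (rule range_from_nat_into) (use assms(4) in auto)
  then have x: "x i \<in> carrier A" for i
    using assms(3) by (metis insert_subset rangeI subsetD zero_closed)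
  define P :: "('k poly list \<Rightarrow> 'a) \<times> 'k poly \<times> 'k" where "P = ((\<lambda>w. \<zero>), 0, 1)"
  define Q :: "('k poly list \<Rightarrow> 'a) \<times> 'k poly \<times> 'k" where "Q = (quad A x, 1, 0)"
  have PQ: "{P, Q} \<subseteq> carrier (big_alg A)"
    using quad_sym_multilinear[of x, OF x] by (simp add: P_def Q_def sym_multilinear_def)
  define M where "M = lie_span (big_alg A) {P, Q}"
  have M: "lie_subalgebra (big_alg A) M"
    unfolding M_def by (rule W.lie_subalgebra_span[OF PQ])
  have PQM: "{P, Q} \<subseteq> M"
    unfolding M_def by (rule lie_span_superset)
  have embed_M: "const_embed A z \<in> M" if "z \<in> carrier A" for z
  proof -
    \<comment> \<open>The elements embedded into \<open>M\<close> form a subalgebra of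
      \<open>A\<close>, so it is enough to treat the generators.\<close>
    have "lie_subalgebra A {z \<in> carrier A. const_embed A z \<in> M}"
      using M lie_hom_const_embed const_embed_zero by (auto simp: lie_subalgebra_def lie_hom_def)
    moreover have "S \<subseteq> {z \<in> carrier A. const_embed A z \<in> M}"
    proof
      fix z assume "z \<in> S"
      then obtain i where "z = x i" using range_x by (metis imageE insertCI)
      then show "z \<in> {z \<in> carrier A. const_embed A z \<in> M}"
        using const_embed_generators[of x M i] x M PQM by (simp add: P_def Q_def)
    qed
    ultimately show ?thesis
      using lie_span_least[of S _ A] assms(5) that by blast
  qed
  let ?B = "(big_alg A)\<lparr>carrier := M\<rparr>"
  interpret B: lie_algebra ?B by (rule W.lie_algebra_subalgebra[OF M])
  have span_B: "lie_span ?B {P, Q} = carrier ?B"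
  proof
    show "lie_span ?B {P, Q} \<subseteq> carrier ?B"
      using PQM by (intro lie_span_least B.lie_subalgebra_carrier) simp
    have "lie_subalgebra ?B (lie_span ?B {P, Q})"
      using PQM by (intro B.lie_subalgebra_span) simp
    \<comment> \<open>A subalgebra of \<open>?B\<close> is one of the ambient algebra, so generating
      inside \<open>M\<close> gives the same span.\<close>
    then have "lie_subalgebra (big_alg A) (lie_span ?B {P, Q})"
      using M by (auto simp: lie_subalgebra_def)
    then have "lie_span (big_alg A) {P, Q} \<subseteq> lie_span ?B {P, Q}"
      by (intro lie_span_least lie_span_superset)
    then show "carrier ?B \<subseteq> lie_span ?B {P, Q}" by (simp add: M_def)
  qed
  have inf: "infinite (UNIV :: (nat \<times> 'k) set)"
    by (simp add: finite_prod)
  \<comment> \<open>The factor \<open>nat\<close> makes the target infinite and the factor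
    \<open>'k\<close> makes it bound the scalars; the resulting injection \<open>g\<close> moves
    \<open>M\<close> to the required type.\<close>
  have "|M| \<le>o |UNIV :: (nat \<times> 'k) set|"
    unfolding M_def
  proof (rule card_of_lie_span[OF W.lie_algebra_axioms PQ inf])
    show "|{P, Q}| \<le>o |UNIV :: (nat \<times> 'k) set|"
      by (rule card_of_ordLeqI[of "\<lambda>z. (if z = P then 0 else 1, 0)"])
        (auto intro: inj_onI split: if_splits)
    show "|UNIV :: 'k set| \<le>o |UNIV :: (nat \<times> 'k) set|"
      by (rule card_of_ordLeqI[of "\<lambda>c. (0, c)"]) (auto intro: inj_onI)
  qed
  then obtain g :: "('k poly list \<Rightarrow> 'a) \<times> 'k poly \<times> 'k \<Rightarrow> nat \<times> 'k" where "inj_on g M"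
    unfolding card_of_ordLeq[symmetric] by blast
  then have g: "inj_on g (carrier ?B)" by simp
  note T = B.transport_simps[OF g]
  show ?thesis
  proof (intro exI conjI bexI)
    show "is_lie_algebra (transport g ?B)"
      using B.lie_algebra_transport[OF g] by (simp add: lie_algebra_iff)
    show "lie_hom A (transport g ?B) (g \<circ> const_embed A)"
      using lie_hom_const_embed embed_M T by (simp add: lie_hom_def)
    show "inj_on (g \<circ> const_embed A) (carrier A)"
      using inj_on_const_embed g embed_M by (intro comp_inj_on) (auto intro: inj_on_subset)
    show "lie_span (transport g ?B) {g P, g Q} = carrier (transport g ?B)"
      using B.lie_span_transport[OF g, of "{P, Q}"] span_B PQM by simp
    show "g P \<in> carrier (transport g ?B)" "g Q \<in> carrier (transport g ?B)"
      using T(1) PQM by auto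
  qed
qed

end
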